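(* Let $R=(a,b)\times(c,d)\subset\mathbb R^2\simeq\mathbb C$ be an open rectangle with $a<b$ and $c<d$, let $p=p_1+ip_2\in R$, and let $f:\mathbb D\to R$ be harmonic with $f(0)=p$. Then $$|f_z(0)|+|f_{\overline z}(0)|\le M_R(p),\qquad M_R(p)=\bigl(A_R(p_1)^2+B_R(p_2)^2\bigr)^{1/2},$$ where $$A_R(p_1)=\frac{2(b-a)}{\pi}\sin\frac{\pi(p_1-a)}{b-a},\qquad B_R(p_2)=\frac{2(d-c)}{\pi}\sin\frac{\pi(p_2-c)}{d-c}.$$ The estimate is sharp for every $p\in R$; equivalently, $$\sup\{|f_z(0)|+|f_{\overline z}(0)|: f:\mathbb D\to R\ \text{harmonic},\ f(0)=p\}=M_R(p).$$
   Context: $\mathbb D=\{z\in\mathbb C:|z|<1\}$. A map $f=u+iv$ is harmonic if $u$ and $v$ are harmonic. $f_z=\frac12(f_x-if_y)$ and $f_{\overline z}=\frac12(f_x+if_y)$. *)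

theory Defs
  imports "HOL-Analysis.Analysis"
begin

text \<open>Partial derivatives with respect to \<open>x\<close> and \<open>y\<close> of a function of \<open>z = x + iy\<close>.\<close>

definition partial_x :: "(complex \<Rightarrow> 'a::real_normed_vector) \<Rightarrow> complex \<Rightarrow> 'a" where
  "partial_x g z = vector_derivative (\<lambda>t. g (z + of_real t)) (at 0)"

definition partial_y :: "(complex \<Rightarrow> 'a::real_normed_vector) \<Rightarrow> complex \<Rightarrow> 'a" where
  "partial_y g z = vector_derivative (\<lambda>t. g (z + \<i> * of_real t)) (at 0)"

text \<open>
  Since \<^const>\<open>vector_derivative\<close> is total, existence of the partial derivatives has to be
  required separately.
\<close>

definition C1_on :: "complex set \<Rightarrow> (complex \<Rightarrow> real) \<Rightarrow> bool" where
  "C1_on S u \<longleftrightarrow>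
     (\<forall>z\<in>S. (\<lambda>t::real. u (z + of_real t)) differentiable at 0 \<and>
            (\<lambda>t::real. u (z + \<i> * of_real t)) differentiable at 0) \<and>
     continuous_on S (partial_x u) \<and> continuous_on S (partial_y u)"

definition C2_on :: "complex set \<Rightarrow> (complex \<Rightarrow> real) \<Rightarrow> bool" where
  "C2_on S u \<longleftrightarrow> C1_on S u \<and> C1_on S (partial_x u) \<and> C1_on S (partial_y u)"

definition harmonic_on :: "complex set \<Rightarrow> (complex \<Rightarrow> real) \<Rightarrow> bool" where
  "harmonic_on S u \<longleftrightarrow> open S \<and> C2_on S u \<and>
     (\<forall>z\<in>S. partial_x (partial_x u) z + partial_y (partial_y u) z = 0)"

definition harmonic_map_on :: "complex set \<Rightarrow> (complex \<Rightarrow> complex) \<Rightarrow> bool" where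
  "harmonic_map_on S f \<longleftrightarrow> harmonic_on S (\<lambda>z. Re (f z)) \<and> harmonic_on S (\<lambda>z. Im (f z))"

definition wirtinger_z :: "(complex \<Rightarrow> complex) \<Rightarrow> complex \<Rightarrow> complex" where
  "wirtinger_z f z = (1/2) * (partial_x f z - \<i> * partial_y f z)"

definition wirtinger_zbar :: "(complex \<Rightarrow> complex) \<Rightarrow> complex \<Rightarrow> complex" where
  "wirtinger_zbar f z = (1/2) * (partial_x f z + \<i> * partial_y f z)"

definition open_rect :: "real \<Rightarrow> real \<Rightarrow> real \<Rightarrow> real \<Rightarrow> complex set" where
  "open_rect a b c d = {z. Re z \<in> {a<..<b} \<and> Im z \<in> {c<..<d}}"

definition A_rect :: "real \<Rightarrow> real \<Rightarrow> real \<Rightarrow> real" where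
  "A_rect a b p1 = 2 * (b - a) / pi * sin (pi * (p1 - a) / (b - a))"

definition B_rect :: "real \<Rightarrow> real \<Rightarrow> real \<Rightarrow> real" where
  "B_rect c d p2 = 2 * (d - c) / pi * sin (pi * (p2 - c) / (d - c))"

definition M_rect :: "real \<Rightarrow> real \<Rightarrow> real \<Rightarrow> real \<Rightarrow> complex \<Rightarrow> real" where
  "M_rect a b c d p = sqrt ((A_rect a b (Re p))\<^sup>2 + (B_rect c d (Im p))\<^sup>2)"

end

theory Submission
  imports Defs "HOL-Complex_Analysis.Conformal_Mappings"
begin

text \<open>
  On the disc, \<open>Re f = Re F\<close> and \<open>Im f = Re G\<close> with \<open>F\<close>, \<open>G\<close> holomorphic, so that
  \<open>2 f_z = F' + \<i> G'\<close> and \<open>2 f_zbar = cnj (F' - \<i> G')\<close>. By the parallelogram law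
  \<open>|f_z| + |f_zbar| \<le> sqrt (|F'|^2 + |G'|^2)\<close>. Both \<open>F\<close> and \<open>G\<close> map into strips, and Schwarz's lemma
  bounds their derivatives at \<open>0\<close> by \<open>A_R\<close> and \<open>B_R\<close>. Equality holds when \<open>F\<close> and \<open>G\<close> are conformal maps
  onto the two strips, rotated so that \<open>F'(0)\<close> and \<open>G'(0)\<close> are both positive: then
  \<open>|F' + \<i> G'| = |F' - \<i> G'|\<close>.
\<close>

section \<open>Directional derivatives of C1 and C2 functions\<close>

text \<open>\<open>C1_on\<close> speaks only of differentiability at parameter 0. Shifting the base
  point gives the derivative at every parameter of a line, as the mean value theorem
  requires.\<close>

lemma C1_on_partial_x:
  assumes "C1_on S u" "z + of_real t \<in> S"
  shows "((\<lambda>t. u (z + of_real t)) has_real_derivative partial_x u (z + of_real t)) (at t)"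
proof -
  have "(\<lambda>s::real. u (z + of_real t + of_real s)) differentiable at 0"
    using assms by (auto simp: C1_on_def)
  then have "((\<lambda>s. u (z + of_real t + of_real s)) has_real_derivative partial_x u (z + of_real t)) (at 0)"
    by (simp add: partial_x_def vector_derivative_works has_real_derivative_iff_has_vector_derivative)
  then have "((\<lambda>s. u (z + of_real (s + t))) has_real_derivative partial_x u (z + of_real t)) (at 0)"
    by (simp add: algebra_simps)
  then show ?thesis
    using DERIV_shift[of "\<lambda>s. u (z + of_real s)" _ 0 t] by simp
qed

lemma C1_on_partial_y:
  assumes "C1_on S u" "z + \<i> * of_real t \<in> S"
  shows "((\<lambda>t. u (z + \<i> * of_real t)) has_real_derivative partial_y u (z + \<i> * of_real t)) (at t)"
proof -
  have "(\<lambda>s::real. u (z + \<i> * of_real t + \<i> * of_real s)) differentiable at 0"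
    using assms by (auto simp: C1_on_def)
  then have "((\<lambda>s. u (z + \<i> * of_real t + \<i> * of_real s)) has_real_derivative partial_y u (z + \<i> * of_real t)) (at 0)"
    by (simp add: partial_y_def vector_derivative_works has_real_derivative_iff_has_vector_derivative)
  then have "((\<lambda>s. u (z + \<i> * of_real (s + t))) has_real_derivative partial_y u (z + \<i> * of_real t)) (at 0)"
    by (simp add: algebra_simps)
  then show ?thesis
    using DERIV_shift[of "\<lambda>s. u (z + \<i> * of_real s)" _ 0 t] by simp
qed

text \<open>The mean value theorem is applied twice: first along \<open>e\<close> to the difference
  of \<open>u\<close> on two parallel segments, then along \<open>e'\<close> to \<open>ue\<close>.
  The directions stay arbitrary so that 1 and \<open>\<i>\<close> can be inserted in either
  order.\<close>

lemma second_difference_mean_value: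
  fixes u ue uee' :: "complex \<Rightarrow> real" and e e' p :: complex
  assumes e: "norm e = 1" "norm e' = 1" and s: "0 < s"
    and due: "\<And>z t. z + e * of_real t \<in> cball p (2 * s) \<Longrightarrow>
      ((\<lambda>t. u (z + e * of_real t)) has_real_derivative ue (z + e * of_real t)) (at t)"
    and duee': "\<And>z t. z + e' * of_real t \<in> cball p (2 * s) \<Longrightarrow>
      ((\<lambda>t. ue (z + e' * of_real t)) has_real_derivative uee' (z + e' * of_real t)) (at t)"
  obtains w where "w \<in> cball p (2 * s)"
    "u (p + e * of_real s + e' * of_real s) - u (p + e * of_real s) - u (p + e' * of_real s) + u p = s\<^sup>2 * uee' w"
proof -
  have dist_le: "p + e * of_real x + e' * of_real y \<in> cball p (2 * s)"
    if "0 \<le> x" "x \<le> s" "0 \<le> y" "y \<le> s" for x y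
  proof -
    have "norm (e * of_real x + e' * of_real y) \<le> x + y"
      using norm_triangle_ineq[of "e * of_real x" "e' * of_real y"] e that by (simp add: norm_mult)
    moreover have "dist p (p + q) = norm q" for q
      by (simp add: dist_norm)
    ultimately show ?thesis
      using that by (simp add: add.assoc)
  qed
  have 1: "((\<lambda>t. u (p + e' * of_real s + e * of_real t) - u (p + e * of_real t)) has_real_derivative
      ue (p + e' * of_real s + e * of_real t) - ue (p + e * of_real t)) (at t)"
    if "0 \<le> t" "t \<le> s" for t
  proof (intro DERIV_diff due)
    show "p + e' * of_real s + e * of_real t \<in> cball p (2 * s)"
      using dist_le[of t s] that s by (simp add: add_ac)
    show "p + e * of_real t \<in> cball p (2 * s)"
      using dist_le[of t 0] that s by simp
  qed
  obtain \<xi> where \<xi>: "0 < \<xi>" "\<xi> < s"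
    "(u (p + e' * of_real s + e * of_real s) - u (p + e * of_real s)) - (u (p + e' * of_real s) - u p)
      = s * (ue (p + e' * of_real s + e * of_real \<xi>) - ue (p + e * of_real \<xi>))"
    using MVT2[OF s 1] by auto
  have 2: "((\<lambda>t. ue (p + e * of_real \<xi> + e' * of_real t)) has_real_derivative
      uee' (p + e * of_real \<xi> + e' * of_real t)) (at t)"
    if "0 \<le> t" "t \<le> s" for t
    using duee' dist_le \<xi> that by auto
  obtain \<eta> where \<eta>: "0 < \<eta>" "\<eta> < s"
    "ue (p + e * of_real \<xi> + e' * of_real s) - ue (p + e * of_real \<xi>)
      = s * uee' (p + e * of_real \<xi> + e' * of_real \<eta>)"
    using MVT2[OF s 2] by auto
  show thesis
  proof
    show "p + e * of_real \<xi> + e' * of_real \<eta> \<in> cball p (2 * s)"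
      using dist_le \<xi> \<eta> by auto
    show "u (p + e * of_real s + e' * of_real s) - u (p + e * of_real s) - u (p + e' * of_real s) + u p
      = s\<^sup>2 * uee' (p + e * of_real \<xi> + e' * of_real \<eta>)"
      using \<xi>(3) \<eta>(3) by (simp add: add_ac power2_eq_square algebra_simps)
  qed
qed

text \<open>The second difference of \<open>u\<close> over a small square is symmetric in the two
  directions, so both mixed derivatives take a common value close to \<open>p\<close>. Continuity of
  both at \<open>p\<close> then forces equality there.\<close>

lemma partial_commute:
  assumes S: "open S" and u: "C2_on S u" and p: "p \<in> S"
  shows "partial_y (partial_x u) p = partial_x (partial_y u) p"
proof (rule ccontr)
  let ?v = "partial_y (partial_x u)" and ?w = "partial_x (partial_y u)"
  assume ne: "?v p \<noteq> ?w p"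
  \<comment> \<open>Half the gap: two values lying within \<open>\<epsilon>\<close> of
    \<open>?v p\<close> and \<open>?w p\<close> respectively cannot coincide.\<close>
  define \<epsilon> where "\<epsilon> = \<bar>?v p - ?w p\<bar> / 2"
  have "\<epsilon> > 0" using ne by (simp add: \<epsilon>_def)
  have C1: "C1_on S u" "C1_on S (partial_x u)" "C1_on S (partial_y u)"
    using u by (auto simp: C2_on_def)
  have "isCont ?v p" "isCont ?w p"
    using C1 S p by (auto simp: C1_on_def continuous_on_eq_continuous_at)
  obtain d1 where d1: "d1 > 0" "\<And>z. dist z p < d1 \<Longrightarrow> dist (?v z) (?v p) < \<epsilon>"
    using \<open>isCont ?v p\<close> \<open>\<epsilon> > 0\<close> unfolding continuous_at_eps_delta by blast
  obtain d2 where d2: "d2 > 0" "\<And>z. dist z p < d2 \<Longrightarrow> dist (?w z) (?w p) < \<epsilon>"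
    using \<open>isCont ?w p\<close> \<open>\<epsilon> > 0\<close> unfolding continuous_at_eps_delta by blast
  obtain r where r: "r > 0" "ball p r \<subseteq> S"
    using S p open_contains_ball by blast
  define s where "s = min r (min d1 d2) / 3"
  have s: "s > 0" "2 * s < r" "2 * s < d1" "2 * s < d2"
    using r d1 d2 by (auto simp: s_def)
  have sub: "cball p (2 * s) \<subseteq> S"
  proof -
    have "cball p (2 * s) \<subseteq> ball p r" using s by auto
    then show ?thesis using r by blast
  qed
  have dx: "((\<lambda>t. g (z + 1 * of_real t)) has_real_derivative partial_x g (z + 1 * of_real t)) (at t)"
    if "C1_on S g" "z + 1 * of_real t \<in> cball p (2 * s)" for g z t
    using C1_on_partial_x[OF that(1)] that(2) sub by auto
  have dy: "((\<lambda>t. g (z + \<i> * of_real t)) has_real_derivative partial_y g (z + \<i> * of_real t)) (at t)"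
    if "C1_on S g" "z + \<i> * of_real t \<in> cball p (2 * s)" for g z t
    using C1_on_partial_y[OF that(1)] that(2) sub by auto
  let ?\<Delta> = "u (p + 1 * of_real s + \<i> * of_real s) - u (p + 1 * of_real s) - u (p + \<i> * of_real s) + u p"
  obtain z1 where z1: "z1 \<in> cball p (2 * s)" "?\<Delta> = s\<^sup>2 * ?v z1"
    by (rule second_difference_mean_value[OF _ _ s(1) dx[OF C1(1)] dy[OF C1(2)]]) auto
  obtain z2 where z2: "z2 \<in> cball p (2 * s)"
     "u (p + \<i> * of_real s + 1 * of_real s) - u (p + \<i> * of_real s) - u (p + 1 * of_real s) + u p = s\<^sup>2 * ?w z2"
    by (rule second_difference_mean_value[OF _ _ s(1) dy[OF C1(1)] dx[OF C1(3)]]) auto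
  have "s\<^sup>2 * ?v z1 = s\<^sup>2 * ?w z2"
    using z1(2) z2(2) by (simp add: algebra_simps)
  then have "?v z1 = ?w z2" using s by simp
  moreover have "dist (?v z1) (?v p) < \<epsilon>" "dist (?w z2) (?w p) < \<epsilon>"
    using d1(2)[of z1] d2(2)[of z2] z1(1) z2(1) s by (simp_all add: dist_commute)
  ultimately show False
    using dist_triangle_half_r[of "?v z1" "?v p" "2 * \<epsilon>" "?w p"] by (simp add: \<epsilon>_def dist_real_def)
qed

text \<open>Passes from continuous partial derivatives to total differentiability. In real
  coordinates this is \<open>has_derivative_partialsI\<close>, which takes the x-derivative at the
  point and a y-derivative nearby that is continuous at the point.\<close>

lemma C1_on_has_derivative:
  assumes S: "open S" and u: "C1_on S u" and p: "p \<in> S"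
  shows "(u has_derivative (\<lambda>h. Re h * partial_x u p + Im h * partial_y u p)) (at p)"
proof -
  obtain r where r: "r > 0" "ball p r \<subseteq> S"
    using S p open_contains_ball by blast
  \<comment> \<open>Half the radius on each axis keeps the product of the two intervals inside
    \<open>ball p r\<close>.\<close>
  define X where "X = ball (Re p) (r/2)"
  define Y where "Y = ball (Im p) (r/2)"
  have sub: "Complex x y \<in> S" if "x \<in> X" "y \<in> Y" for x y
  proof -
    have "norm (Complex x y - p) \<le> \<bar>x - Re p\<bar> + \<bar>y - Im p\<bar>"
      using cmod_le[of "Complex x y - p"] by simp
    also have "\<dots> < r"
      using that by (auto simp: X_def Y_def dist_real_def abs_minus_commute)
    finally show ?thesis using r by (auto simp: dist_norm norm_minus_commute)
  qed
  have op: "open X" "open Y" and pXY: "Re p \<in> X" "Im p \<in> Y"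
    using r by (auto simp: X_def Y_def)
  \<comment> \<open>The rule for partial derivatives expects a bounded linear map, so multiplication
    by a real number is written as a multiple of the identity.\<close>
  define fy where "fy x y = partial_y u (Complex x y) *\<^sub>R (id_blinfun :: real \<Rightarrow>\<^sub>L real)" for x y
  have Cxy: "Complex x y = (of_real x) + \<i> * of_real y" for x y
    by (simp add: complex_eq_iff)
  have fy_eq: "blinfun_apply (fy x y) = (*) (partial_y u (Complex x y))" for x y
    by (simp add: fun_eq_iff fy_def blinfun.scaleR_left)
  have "((\<lambda>(x, y). u (Complex x y)) has_derivative
      (\<lambda>(tx, ty). partial_x u p * tx + fy (Re p) (Im p) ty)) (at (Re p, Im p) within X \<times> Y)"
  proof (rule has_derivative_partialsI)
    have "((\<lambda>t. u (\<i> * of_real (Im p) + of_real t)) has_real_derivative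
        partial_x u (\<i> * of_real (Im p) + of_real (Re p))) (at (Re p))"
      by (rule C1_on_partial_x[OF u]) (use p complex_eq[of p] in \<open>simp add: add_ac\<close>)
    then have "((\<lambda>x. u (Complex x (Im p))) has_real_derivative partial_x u p) (at (Re p))"
      using complex_eq[of p] by (simp add: Cxy add_ac)
    then show "((\<lambda>x. u (Complex x (Im p))) has_derivative (*) (partial_x u p)) (at (Re p) within X)"
      using has_field_derivative_at_within has_field_derivative_def by blast
  next
    fix x y assume "x \<in> X" "y \<in> Y"
    then have "((\<lambda>t. u (of_real x + \<i> * of_real t)) has_real_derivative
        partial_y u (of_real x + \<i> * of_real y)) (at y)"
      by (intro C1_on_partial_y[OF u]) (use sub in \<open>simp flip: Cxy\<close>)
    then show "((\<lambda>y. u (Complex x y)) has_derivative blinfun_apply (fy x y)) (at y within Y)"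
      using has_field_derivative_at_within
      by (simp add: fy_eq has_field_derivative_def has_derivative_at_withinI Cxy)
  next
    have "isCont (partial_y u) p"
      using u S p by (auto simp: C1_on_def continuous_on_eq_continuous_at)
    then have c: "isCont (partial_y u) (Complex (fst (Re p, Im p)) (snd (Re p, Im p)))"
      by simp
    have "isCont (\<lambda>q. Complex (fst q) (snd q)) (Re p, Im p)"
      unfolding Cxy by (intro continuous_intros)
    from isCont_o2[OF this c]
    have "isCont (\<lambda>q. partial_y u (Complex (fst q) (snd q)) *\<^sub>R (id_blinfun :: real \<Rightarrow>\<^sub>L real)) (Re p, Im p)"
      by (intro continuous_intros) auto
    then show "continuous (at (Re p, Im p) within X \<times> Y) (\<lambda>(x, y). fy x y)"
      by (auto simp: fy_def split_beta' intro: continuous_at_imp_continuous_at_within)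
  qed (use pXY in \<open>auto simp: Y_def\<close>)
  then have "((\<lambda>(x, y). u (Complex x y)) has_derivative
      (\<lambda>(tx, ty). partial_x u p * tx + fy (Re p) (Im p) ty)) (at (Re p, Im p))"
    using at_within_open[of "(Re p, Im p)" "X \<times> Y"] op pXY by (auto simp: open_Times)
  moreover have "((\<lambda>z. (Re z, Im z)) has_derivative (\<lambda>h. (Re h, Im h))) (at p)"
    by (intro has_derivative_Pair has_derivative_Re has_derivative_Im has_derivative_ident)
  ultimately
  have "((\<lambda>z. u (Complex (Re z) (Im z))) has_derivative
      (\<lambda>h. partial_x u p * Re h + partial_y u p * Im h)) (at p)"
    by (auto simp: fy_eq dest: has_derivative_compose[rotated])
  then show ?thesis by (simp add: mult.commute)
qed

section \<open>Harmonic functions and real parts of holomorphic functions\<close>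

text \<open>The function \<open>g\<close>, which is u_x - i u_y, is holomorphic and so has a
  primitive \<open>G\<close> on the convex set. The real part of \<open>G\<close> has the same
  gradient as \<open>u\<close>, and the remaining real constant is absorbed into
  \<open>F\<close>.\<close>

lemma harmonic_on_Re_primitive:
  assumes S: "convex S" and u: "harmonic_on S u"
  obtains F where "F holomorphic_on S" "\<And>z. z \<in> S \<Longrightarrow> u z = Re (F z)"
proof (cases "S = {}")
  case False
  have opS: "open S" and C2: "C2_on S u"
    and lap: "\<And>z. z \<in> S \<Longrightarrow> partial_x (partial_x u) z + partial_y (partial_y u) z = 0"
    using u by (auto simp: harmonic_on_def)
  have C1: "C1_on S u" "C1_on S (partial_x u)" "C1_on S (partial_y u)"
    using C2 by (auto simp: C2_on_def)
  define g where "g z = of_real (partial_x u z) - \<i> * of_real (partial_y u z)" for z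
  have "g field_differentiable (at z)" if z: "z \<in> S" for z
  proof -
    let ?D = "of_real (partial_x (partial_x u) z) - \<i> * of_real (partial_x (partial_y u) z)"
    have "(g has_derivative (\<lambda>h. of_real (Re h * partial_x (partial_x u) z + Im h * partial_y (partial_x u) z)
        - \<i> * of_real (Re h * partial_x (partial_y u) z + Im h * partial_y (partial_y u) z))) (at z)"
      unfolding g_def
      by (intro has_derivative_diff has_derivative_of_real has_derivative_mult_right
          C1_on_has_derivative[OF opS] C1 z)
    \<comment> \<open>These are the Cauchy-Riemann equations for \<open>g\<close>: the Laplace
      equation gives one and the symmetry of mixed derivatives the other, which makes the
      real-linear derivative complex-linear.\<close>
    moreover have "(\<lambda>h. of_real (Re h * partial_x (partial_x u) z + Im h * partial_y (partial_x u) z)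
        - \<i> * of_real (Re h * partial_x (partial_y u) z + Im h * partial_y (partial_y u) z)) = (*) ?D"
      using lap[OF z] partial_commute[OF opS C2 z]
      by (auto simp: fun_eq_iff complex_eq_iff algebra_simps add_eq_0_iff2)
    ultimately show ?thesis
      by (auto simp: field_differentiable_def has_field_derivative_def)
  qed
  then have "g holomorphic_on S"
    using field_differentiable_at_within by (auto simp: holomorphic_on_def)
  then obtain G where "\<And>x. x \<in> S \<Longrightarrow> (G has_field_derivative g x) (at x within S)"
    using holomorphic_convex_primitive'[OF S opS] by blast
  then have G: "\<And>x. x \<in> S \<Longrightarrow> (G has_field_derivative g x) (at x)"
    using at_within_open[OF _ opS] by metis
  have "((\<lambda>z. u z - Re (G z)) has_derivative (\<lambda>h. 0)) (at z within S)" if z: "z \<in> S" for z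
  proof (rule has_derivative_at_withinI)
    have "((\<lambda>z. u z - Re (G z)) has_derivative
      (\<lambda>h. (Re h * partial_x u z + Im h * partial_y u z) - Re (g z * h))) (at z)"
      using G[OF z] unfolding has_field_derivative_def
      by (intro has_derivative_diff has_derivative_Re C1_on_has_derivative[OF opS] C1 z)
    then show "((\<lambda>z. u z - Re (G z)) has_derivative (\<lambda>h. 0)) (at z)"
      by (simp add: g_def algebra_simps)
  qed
  then obtain c where c: "\<And>z. z \<in> S \<Longrightarrow> u z - Re (G z) = c"
    using has_derivative_zero_constant[OF S, of "\<lambda>z. u z - Re (G z)"] by auto
  show thesis
  proof
    show "(\<lambda>z. G z + of_real c) holomorphic_on S"
      using G opS by (intro holomorphic_intros) (auto simp: holomorphic_on_open)
    show "u z = Re (G z + of_real c)" if "z \<in> S" for z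
      using c[OF that] by simp
  qed
qed (use that[of "\<lambda>_. 0"] in simp)

text \<open>The directions 1 and \<open>\<i>\<close> yield the two partial derivatives. Allowing any
  \<open>u\<close> that agrees with the real part on \<open>S\<close> lets later lemmas apply to
  partial derivatives, whose formulas are known only on \<open>S\<close>.\<close>

lemma Re_holomorphic_curve_derivative:
  assumes S: "open S" and F: "F holomorphic_on S" and u: "\<And>z. z \<in> S \<Longrightarrow> u z = Re (F z)"
    and z: "z \<in> S"
  shows "((\<lambda>t::real. u (z + e * of_real t)) has_vector_derivative Re (e * deriv F z)) (at 0)"
proof -
  have "(F has_field_derivative deriv F z) (at (z + e * of_real 0))"
    using F S z by (simp add: holomorphic_derivI)
  moreover have "((\<lambda>t::real. z + e * of_real t) has_vector_derivative e) (at 0)"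
    by (auto intro!: derivative_eq_intros)
  ultimately have "((\<lambda>t::real. F (z + e * of_real t)) has_vector_derivative e * deriv F z) (at 0)"
    using field_vector_diff_chain_at[of "\<lambda>t::real. z + e * of_real t" e 0 F] by (simp add: o_def)
  then have "((\<lambda>t::real. Re (F (z + e * of_real t))) has_vector_derivative Re (e * deriv F z)) (at 0)"
    by (rule bounded_linear.has_vector_derivative[OF bounded_linear_Re])
  moreover have "open ((\<lambda>t::real. z + e * of_real t) -` S)"
    by (intro open_vimage S continuous_intros)
  ultimately show ?thesis
    by (rule has_vector_derivative_transform_within_open) (use z u in auto)
qed

lemma partial_Re_holomorphic:
  assumes "open S" "F holomorphic_on S" "\<And>z. z \<in> S \<Longrightarrow> u z = Re (F z)" "z \<in> S"
  shows "partial_x u z = Re (deriv F z)" "partial_y u z = Re (\<i> * deriv F z)"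
  using Re_holomorphic_curve_derivative[OF assms, of 1] Re_holomorphic_curve_derivative[OF assms, of \<i>]
  unfolding partial_x_def partial_y_def by (auto intro: vector_derivative_at)

lemma C1_on_Re_holomorphic:
  assumes S: "open S" and F: "F holomorphic_on S" and u: "\<And>z. z \<in> S \<Longrightarrow> u z = Re (F z)"
  shows "C1_on S u"
  unfolding C1_on_def
proof (intro conjI ballI)
  fix z assume z: "z \<in> S"
  show "(\<lambda>t::real. u (z + of_real t)) differentiable at 0"
    using Re_holomorphic_curve_derivative[OF S F u z, of 1] by (auto intro: differentiableI_vector)
  show "(\<lambda>t::real. u (z + \<i> * of_real t)) differentiable at 0"
    using Re_holomorphic_curve_derivative[OF S F u z, of \<i>] by (auto intro: differentiableI_vector)
next
  have c: "continuous_on S (deriv F)"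
    using F S holomorphic_deriv holomorphic_on_imp_continuous_on by blast
  have "continuous_on S (\<lambda>z. Re (deriv F z))" "continuous_on S (\<lambda>z. Re (\<i> * deriv F z))"
    by (intro continuous_intros c)+
  then show "continuous_on S (partial_x u)" "continuous_on S (partial_y u)"
    using partial_Re_holomorphic[OF S F u] by (auto cong: continuous_on_cong)
qed

text \<open>The partial derivatives are the real parts of F' and iF', again holomorphic. Repeating
  the computation gives the second derivatives Re F'' and -Re F'', which cancel.\<close>

lemma harmonic_on_Re_holomorphic:
  assumes S: "open S" and F: "F holomorphic_on S"
  shows "harmonic_on S (\<lambda>z. Re (F z))"
proof -
  let ?u = "\<lambda>z. Re (F z)"
  have F': "deriv F holomorphic_on S" "(\<lambda>z. \<i> * deriv F z) holomorphic_on S"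
    using F S by (auto intro!: holomorphic_intros)
  note p = partial_Re_holomorphic[OF S F refl]
  have "C2_on S ?u"
    unfolding C2_on_def using C1_on_Re_holomorphic[OF S] F F' p by auto
  moreover have "partial_x (partial_x ?u) z + partial_y (partial_y ?u) z = 0" if z: "z \<in> S" for z
  proof -
    have "deriv F field_differentiable at z"
      using F' S z holomorphic_on_imp_differentiable_at by blast
    then have "deriv (\<lambda>z. \<i> * deriv F z) z = \<i> * deriv (deriv F) z"
      by simp
    then show ?thesis
      using partial_Re_holomorphic(1)[OF S F'(1) p(1) z] partial_Re_holomorphic(2)[OF S F'(2) p(2) z]
      by simp
  qed
  ultimately show ?thesis
    using S by (simp add: harmonic_on_def)
qed

text \<open>On \<open>S\<close>, f is the sum of the holomorphic function (F + iG)/2 and the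
  conjugate of (F - iG)/2, which explains the two formulas. The proof verifies them through the real
  components of both partial derivatives.\<close>

lemma wirtinger_of_Re_holomorphic:
  assumes S: "open S" "z \<in> S" and F: "F holomorphic_on S" "G holomorphic_on S"
    and f: "\<And>z. z \<in> S \<Longrightarrow> Re (f z) = Re (F z)" "\<And>z. z \<in> S \<Longrightarrow> Im (f z) = Re (G z)"
  shows "wirtinger_z f z = (deriv F z + \<i> * deriv G z) / 2"
    and "wirtinger_zbar f z = cnj (deriv F z - \<i> * deriv G z) / 2"
proof -
  have *: "((\<lambda>t::real. f (z + e * of_real t)) has_vector_derivative
      Complex (Re (e * deriv F z)) (Re (e * deriv G z))) (at 0)" for e
  proof -
    have "((\<lambda>t::real. of_real (Re (f (z + e * of_real t))) + \<i> * of_real (Im (f (z + e * of_real t))))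
       has_vector_derivative of_real (Re (e * deriv F z)) + \<i> * of_real (Re (e * deriv G z))) (at 0)"
      using Re_holomorphic_curve_derivative[OF S(1) F(1) f(1) S(2), of e]
            Re_holomorphic_curve_derivative[OF S(1) F(2) f(2) S(2), of e]
      by (intro has_vector_derivative_add has_vector_derivative_of_real has_vector_derivative_mult_right)
        (auto simp: has_real_derivative_iff_has_vector_derivative)
    then show ?thesis by (simp flip: complex_eq add: Complex_eq)
  qed
  have "partial_x f z = Complex (Re (deriv F z)) (Re (deriv G z))"
    using *[of 1] unfolding partial_x_def by (auto intro: vector_derivative_at)
  moreover have "partial_y f z = Complex (Re (\<i> * deriv F z)) (Re (\<i> * deriv G z))"
    using *[of \<i>] unfolding partial_y_def by (auto intro: vector_derivative_at)
  ultimately show "wirtinger_z f z = (deriv F z + \<i> * deriv G z) / 2"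
    "wirtinger_zbar f z = cnj (deriv F z - \<i> * deriv G z) / 2"
    by (auto simp: wirtinger_z_def wirtinger_zbar_def complex_eq_iff)
qed

section \<open>Schwarz's lemma for strips\<close>

text \<open>The Cayley transform \<open>\<psi>\<close> carries the half-plane to the disc and
  \<open>h 0\<close> to 0. Schwarz's lemma bounds its derivative at 0, which is h'(0) divided by 2i
  Im h(0).\<close>

lemma Schwarz_upper_half_plane:
  assumes h: "h holomorphic_on ball 0 1" and pos: "\<And>z. z \<in> ball 0 1 \<Longrightarrow> Im (h z) > 0"
  shows "norm (deriv h 0) \<le> 2 * Im (h 0)"
proof -
  let ?w = "h 0"
  define \<psi> where "\<psi> z = (h z - ?w) / (h z - cnj ?w)" for z
  have w: "Im ?w > 0" using pos by simp
  have nz: "h z - cnj ?w \<noteq> 0" if "z \<in> ball 0 1" for z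
    using pos[OF that] w by (auto simp: complex_eq_iff)
  have hol: "\<psi> holomorphic_on ball 0 1"
    unfolding \<psi>_def using nz by (intro holomorphic_intros h) auto
  have lt: "norm (\<psi> z) < 1" if "norm z < 1" for z
  proof -
    have z: "z \<in> ball 0 1" using that by simp
    \<comment> \<open>The two squares differ by 4 Im h(z) Im h(0), a positive number.\<close>
    have "(norm (h z - ?w))\<^sup>2 < (norm (h z - cnj ?w))\<^sup>2"
      using mult_pos_pos[OF pos[OF z] w] unfolding cmod_power2
      by (simp add: power2_eq_square algebra_simps)
    then have "norm (h z - ?w) < norm (h z - cnj ?w)"
      by (rule power2_less_imp_less) simp
    then show ?thesis
      using nz[OF z] by (simp add: \<psi>_def norm_divide divide_simps)
  qed
  have "(h has_field_derivative deriv h 0) (at 0)"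
    using h by (auto intro: holomorphic_derivI)
  then have "(\<psi> has_field_derivative deriv h 0 / (?w - cnj ?w)) (at 0)"
    unfolding \<psi>_def using nz[of 0] by (auto intro!: derivative_eq_intros simp: divide_simps)
  then have "deriv \<psi> 0 = deriv h 0 / (?w - cnj ?w)"
    by (rule DERIV_imp_deriv)
  moreover have "norm (deriv \<psi> 0) \<le> 1"
    by (rule Schwarz_Lemma(2)[OF hol _ lt, of 0]) (auto simp: \<psi>_def)
  moreover have "norm (?w - cnj ?w) = 2 * Im ?w"
    using w by (simp add: complex_diff_cnj norm_mult)
  moreover have "?w - cnj ?w \<noteq> 0" by (rule nz) simp
  ultimately show ?thesis
    using w by (simp add: norm_divide divide_le_eq)
qed

text \<open>The exponential \<open>h\<close> unrolls the strip onto the upper half-plane. Both sides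
  of the half-plane bound carry the factor \<open>exp (- k * Im (F 0))\<close>; once it cancels,
  only the position across the strip matters.\<close>

lemma Schwarz_strip:
  assumes F: "F holomorphic_on ball 0 1"
    and strip: "\<And>z. z \<in> ball 0 1 \<Longrightarrow> Re (F z) \<in> {a<..<b}"
  shows "norm (deriv F 0) \<le> A_rect a b (Re (F 0))"
proof -
  have ab: "a < b" using strip[of 0] by auto
  define k where "k = pi / (b - a)"
  have k: "k > 0" using ab by (simp add: k_def)
  define h where "h z = exp (\<i> * of_real k * (F z - of_real a))" for z
  have Im_h: "Im (h z) = exp (- k * Im (F z)) * sin (k * (Re (F z) - a))" for z
    by (simp add: h_def Im_exp)
  have "norm (deriv h 0) \<le> 2 * Im (h 0)"
  proof (rule Schwarz_upper_half_plane)
    show "h holomorphic_on ball 0 1"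
      unfolding h_def by (intro holomorphic_intros F)
    fix z :: complex assume "z \<in> ball 0 1"
    then have *: "0 < Re (F z) - a" "Re (F z) - a < b - a"
      using strip[of z] by auto
    have "k * (Re (F z) - a) < k * (b - a)"
      using * k by (intro mult_strict_left_mono)
    also have "\<dots> = pi" using ab by (simp add: k_def)
    finally show "Im (h z) > 0"
      unfolding Im_h using * k by (intro mult_pos_pos sin_gt_zero) auto
  qed
  moreover have "deriv h 0 = h 0 * (\<i> * of_real k * deriv F 0)"
  proof (rule DERIV_imp_deriv)
    have "(F has_field_derivative deriv F 0) (at 0)"
      using F by (auto intro: holomorphic_derivI)
    then show "(h has_field_derivative h 0 * (\<i> * of_real k * deriv F 0)) (at 0)"
      unfolding h_def by (auto intro!: derivative_eq_intros)
  qed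
  moreover have "norm (h 0) = exp (- k * Im (F 0))"
    by (simp add: h_def)
  ultimately have "exp (- k * Im (F 0)) * (k * norm (deriv F 0))
      \<le> exp (- k * Im (F 0)) * (2 * sin (k * (Re (F 0) - a)))"
    using k by (simp add: norm_mult Im_h mult_ac)
  then have "k * norm (deriv F 0) \<le> 2 * sin (k * (Re (F 0) - a))"
    by simp
  then have "norm (deriv F 0) \<le> 2 * sin (k * (Re (F 0) - a)) / k"
    using k by (simp add: field_simps)
  also have "\<dots> = A_rect a b (Re (F 0))"
    using ab by (simp add: A_rect_def k_def)
  finally show ?thesis .
qed

text \<open>The equality case of \<open>Schwarz_strip\<close>: a logarithm inverts the exponential
  used there, and \<open>k\<close> is the reciprocal of the earlier scale.\<close>

lemma strip_extremal:
  assumes p: "a < p" "p < b"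
  obtains F where "F holomorphic_on ball 0 1" "\<And>z. z \<in> ball 0 1 \<Longrightarrow> Re (F z) \<in> {a<..<b}"
    "Re (F 0) = p" "deriv F 0 = of_real (A_rect a b p)"
proof -
  define k where "k = (b - a) / pi"
  have k: "k > 0" using p by (simp add: k_def)
  \<comment> \<open>The argument that \<open>h 0\<close> must have: \<open>k * \<alpha>\<close>
    equals \<open>p - a\<close>, so \<open>F 0\<close> lands on \<open>p\<close>.\<close>
  define \<alpha> where "\<alpha> = pi * (p - a) / (b - a)"
  have \<alpha>: "0 < \<alpha>" "\<alpha> < pi"
    using p by (auto simp: \<alpha>_def divide_simps)
  have s: "sin \<alpha> > 0" using \<alpha> by (rule sin_gt_zero)
  \<comment> \<open>A conformal map of the disc onto the upper half-plane with \<open>h 0 = cis \<alpha>\<close>, rotated so that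
      \<open>- \<i> * Ln (h z)\<close> has positive derivative at \<open>0\<close>.\<close>
  define h where "h z = (cis \<alpha> - z) / (1 - cis \<alpha> * z)" for z
  have nz: "1 - cis \<alpha> * z \<noteq> 0" if "z \<in> ball 0 1" for z
  proof
    assume "1 - cis \<alpha> * z = 0"
    then have "norm (cis \<alpha> * z) = 1" by (metis eq_iff_diff_eq_0 norm_one)
    then show False using that by (simp add: norm_mult)
  qed
  have Im_h: "Im (h z) > 0" if z: "z \<in> ball 0 1" for z
  proof -
    have sc: "cos \<alpha> * cos \<alpha> = 1 - sin \<alpha> * sin \<alpha>"
      using sin_cos_squared_add[of \<alpha>] by (simp add: power2_eq_square)
    \<comment> \<open>Multiplying by the conjugate denominator preserves the sign of the imaginary
      part. The terms linear in z combine to minus z + \<open>cnj z\<close>, which is real.\<close>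
    have "Im ((cis \<alpha> - z) * cnj (1 - cis \<alpha> * z)) = sin \<alpha> * (1 - (norm z)\<^sup>2)"
      unfolding cmod_power2 by (simp add: power2_eq_square algebra_simps) (use sc in algebra)
    moreover have "(norm z)\<^sup>2 < 1"
      using z by (simp add: power_less_one_iff)
    ultimately show ?thesis
      using s nz[OF z] by (simp add: h_def Im_complex_div_gt_0)
  qed
  have hol: "h holomorphic_on ball 0 1"
    unfolding h_def using nz by (intro holomorphic_intros) auto
  have nn: "h z \<notin> \<real>\<^sub>\<le>\<^sub>0" if "z \<in> ball 0 1" for z
    using Im_h[OF that] by (auto simp: complex_nonpos_Reals_iff)
  define F where "F z = of_real a + of_real k * (- \<i> * Ln (h z))" for z
  have Re_F: "Re (F z) = a + k * Im (Ln (h z))" for z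
    by (simp add: F_def)
  have Ln0: "Ln (h 0) = \<i> * of_real \<alpha>"
    using \<alpha> by (simp add: h_def cis_conv_exp)
  show thesis
  proof
    show "F holomorphic_on ball 0 1"
      unfolding F_def using nn by (intro holomorphic_intros hol) auto
    show "Re (F 0) = p"
      using p by (simp add: Re_F Ln0 k_def \<alpha>_def)
    show "Re (F z) \<in> {a<..<b}" if z: "z \<in> ball 0 1" for z
    proof -
      have "h z \<noteq> 0" using Im_h[OF z] by auto
      then have *: "0 < Im (Ln (h z))" "Im (Ln (h z)) < pi"
        using Im_Ln_pos_lt_imp Im_Ln_pos_lt Im_h[OF z] by blast+
      have "k * Im (Ln (h z)) < k * pi" using * k by (intro mult_strict_left_mono)
      moreover have "k * pi = b - a" by (simp add: k_def)
      moreover have "0 < k * Im (Ln (h z))" using * k by simp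
      ultimately show ?thesis by (simp add: Re_F)
    qed
    have h0: "h 0 = cis \<alpha>" by (simp add: h_def)
    have "(h has_field_derivative (cis \<alpha>)\<^sup>2 - 1) (at 0)"
      unfolding h_def by (auto intro!: derivative_eq_intros simp: power2_eq_square)
    then have "(F has_field_derivative of_real k * (- \<i> * (((cis \<alpha>)\<^sup>2 - 1) / h 0))) (at 0)"
      unfolding F_def using nn[of 0] by (auto intro!: derivative_eq_intros simp: divide_inverse mult_ac)
    moreover have "- \<i> * (((cis \<alpha>)\<^sup>2 - 1) / h 0) = 2 * of_real (sin \<alpha>)"
    proof -
      have eq: "((cis \<alpha>)\<^sup>2 - 1) / h 0 = cis \<alpha> - cis (- \<alpha>)"
        by (simp add: h0 power2_eq_square diff_divide_distrib cis_divide flip: cis_inverse inverse_eq_divide)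
      show ?thesis unfolding eq by (simp add: complex_eq_iff)
    qed
    ultimately have "(F has_field_derivative of_real k * (2 * of_real (sin \<alpha>))) (at 0)"
      by (simp only:)
    then have "deriv F 0 = of_real k * (2 * of_real (sin \<alpha>))"
      by (rule DERIV_imp_deriv)
    then show "deriv F 0 = of_real (A_rect a b p)"
      by (simp add: A_rect_def k_def \<alpha>_def)
  qed
qed

section \<open>The estimate for the rectangle\<close>

text \<open>The parallelogram law combined with (s + t)^2 \<le> 2(s^2 + t^2), where equality means
  that the two norms agree.\<close>

lemma norm_add_norm_diff_le:
  fixes x y :: "'a::real_inner"
  shows "norm (x + y) + norm (x - y) \<le> 2 * sqrt ((norm x)\<^sup>2 + (norm y)\<^sup>2)"
proof (rule power2_le_imp_le)
  have "(norm (x + y))\<^sup>2 + (norm (x - y))\<^sup>2 = 2 * ((norm x)\<^sup>2 + (norm y)\<^sup>2)"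
    by (simp add: power2_norm_eq_inner inner_simps inner_commute)
  moreover have "(norm (x + y) + norm (x - y))\<^sup>2 \<le> 2 * ((norm (x + y))\<^sup>2 + (norm (x - y))\<^sup>2)"
    using zero_le_power2[of "norm (x + y) - norm (x - y)"]
    by (simp add: power2_eq_square algebra_simps)
  ultimately show "(norm (x + y) + norm (x - y))\<^sup>2 \<le> (2 * sqrt ((norm x)\<^sup>2 + (norm y)\<^sup>2))\<^sup>2"
    by (simp add: power_mult_distrib)
qed simp

text \<open>Lets the strip lemmas, phrased with \<open>A_rect\<close>, serve for the imaginary part
  too.\<close>

lemma B_rect_eq_A_rect: "B_rect = A_rect"
  by (simp add: fun_eq_iff A_rect_def B_rect_def)

theorem theorem4p1:
  fixes a b c d :: real and p :: complex
  assumes "a < b" and "c < d" and "p \<in> open_rect a b c d"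
  shows "(\<forall>f. harmonic_map_on (ball 0 1) f \<and> f ` ball 0 1 \<subseteq> open_rect a b c d \<and> f 0 = p \<longrightarrow>
            cmod (wirtinger_z f 0) + cmod (wirtinger_zbar f 0) \<le> M_rect a b c d p) \<and>
         Sup {cmod (wirtinger_z f 0) + cmod (wirtinger_zbar f 0) | f.
            harmonic_map_on (ball 0 1) f \<and> f ` ball 0 1 \<subseteq> open_rect a b c d \<and> f 0 = p}
          = M_rect a b c d p"
proof -
  let ?P = "\<lambda>f. harmonic_map_on (ball 0 1) f \<and> f ` ball 0 1 \<subseteq> open_rect a b c d \<and> f 0 = p"
  let ?N = "\<lambda>f. cmod (wirtinger_z f 0) + cmod (wirtinger_zbar f 0)"
  have bound: "?N f \<le> M_rect a b c d p" if f: "?P f" for f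
  proof -
    have rect: "Re (f z) \<in> {a<..<b}" "Im (f z) \<in> {c<..<d}" if "z \<in> ball 0 1" for z
      using f that by (auto simp: open_rect_def image_subset_iff)
    obtain F where F: "F holomorphic_on ball 0 1" "\<And>z. z \<in> ball 0 1 \<Longrightarrow> Re (f z) = Re (F z)"
      using f harmonic_on_Re_primitive[of "ball 0 1" "\<lambda>z. Re (f z)"] by (auto simp: harmonic_map_on_def)
    obtain G where G: "G holomorphic_on ball 0 1" "\<And>z. z \<in> ball 0 1 \<Longrightarrow> Im (f z) = Re (G z)"
      using f harmonic_on_Re_primitive[of "ball 0 1" "\<lambda>z. Im (f z)"] by (auto simp: harmonic_map_on_def)
    let ?F = "deriv F 0" and ?G = "deriv G 0"
    have leF: "norm ?F \<le> A_rect a b (Re p)"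
      using Schwarz_strip[OF F(1), of a b] F(2) rect(1) f by (metis centre_in_ball zero_less_one)
    have leG: "norm ?G \<le> B_rect c d (Im p)"
      using Schwarz_strip[OF G(1), of c d] G(2) rect(2) f B_rect_eq_A_rect
      by (metis centre_in_ball zero_less_one)
    have 0: "(0::complex) \<in> ball 0 1" by simp
    have "wirtinger_z f 0 = (?F + \<i> * ?G) / 2" "wirtinger_zbar f 0 = cnj (?F - \<i> * ?G) / 2"
      by (rule wirtinger_of_Re_holomorphic[OF open_ball 0 F(1) G(1) F(2) G(2)], assumption+)+
    then have "?N f = (norm (?F + \<i> * ?G) + norm (?F - \<i> * ?G)) / 2"
      by (simp only: norm_divide complex_mod_cnj) simp
    also have "\<dots> \<le> sqrt ((norm ?F)\<^sup>2 + (norm ?G)\<^sup>2)"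
      using norm_add_norm_diff_le[of ?F "\<i> * ?G"] by (simp add: norm_mult)
    also have "\<dots> \<le> M_rect a b c d p"
      unfolding M_rect_def using leF leG by (intro real_sqrt_le_mono add_mono power_mono) auto
    finally show ?thesis .
  qed
  have ab: "a < Re p" "Re p < b" and cd: "c < Im p" "Im p < d"
    using assms by (auto simp: open_rect_def)
  obtain F where F: "F holomorphic_on ball 0 1" "\<And>z. z \<in> ball 0 1 \<Longrightarrow> Re (F z) \<in> {a<..<b}"
    "Re (F 0) = Re p" "deriv F 0 = of_real (A_rect a b (Re p))"
    using strip_extremal[OF ab] by blast
  obtain G where G: "G holomorphic_on ball 0 1" "\<And>z. z \<in> ball 0 1 \<Longrightarrow> Re (G z) \<in> {c<..<d}"
    "Re (G 0) = Im p" "deriv G 0 = of_real (B_rect c d (Im p))"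
    using strip_extremal[OF cd] B_rect_eq_A_rect by metis
  \<comment> \<open>Only the real parts of the two extremal strip maps are kept, so their images
    fill the two coordinates of the rectangle independently.\<close>
  define f where "f z = Complex (Re (F z)) (Re (G z))" for z
  have Pf: "?P f"
    using F(2,3) G(2,3) harmonic_on_Re_holomorphic[OF open_ball F(1)] harmonic_on_Re_holomorphic[OF open_ball G(1)]
    by (auto simp: f_def harmonic_map_on_def open_rect_def)
  have Nf: "?N f = M_rect a b c d p"
  proof -
    \<comment> \<open>Both derivatives at 0 are real, so conjugating A - iB gives A + iB: the two
      Wirtinger derivatives coincide, each of modulus half of \<open>M_rect\<close>.\<close>
    have "wirtinger_z f 0 = Complex (A_rect a b (Re p)) (B_rect c d (Im p)) / 2"
         "wirtinger_zbar f 0 = Complex (A_rect a b (Re p)) (B_rect c d (Im p)) / 2"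
      using wirtinger_of_Re_holomorphic[of "ball 0 1" 0 F G f] F G
      by (auto simp: f_def Complex_eq)
    then show ?thesis by (simp only: norm_divide complex_norm M_rect_def) simp
  qed
  have "Sup {?N f | f. ?P f} = M_rect a b c d p"
  \<comment> \<open>The supremum is a maximum, attained by \<open>f\<close>.\<close>
  proof (rule cSup_eq_maximum)
    show "M_rect a b c d p \<in> {?N f | f. ?P f}"
      using Pf Nf[symmetric] by blast
  qed (use bound in blast)
  then show ?thesis using bound by blast
qed

end
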